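(* Let $m,n\in\mathbb{N}$ with $m\geq 3$ odd, and set $\ell := \lfloor m/2\rfloor$. Let $p\in\mathbb{Z}_m$ and $A\subseteq \mathcal{E}_m^n(p)$, and put $\alpha := |A|/m^{n-1}$. Then for each choice of sign, \[ |N_n(A, \mathcal{E}_m^n(p\pm 1))| \geq |A|\left(1 + \frac{1-\alpha}{\sqrt{\ell^3 m n}}\right). \]
   Context: The discrete torus $\mathbb{Z}_m^n$ is the graph with vertex set $\{0,1,\ldots,m-1\}^n$ in which $u,v$ are adjacent iff there is $j\in[n]$ with $u_j \equiv v_j \pm 1 \pmod m$ and $u_i=v_i$ for all $i\neq j$. For $p\in\mathbb{Z}_m$, $\mathcal{E}_m^n(p)$ is the set of vertices $v$ with $\sum_{i=1}^n v_i \equiv p \pmod m$. For vertex sets $X,Y$ of a graph $G$, $N_G(X) := \bigcup_{x\in X} N_G(x)\setminus X$ and $N_G(X,Y) := N_G(X)\cap Y$; here $N_n$ stands for $N_{\mathbb{Z}_m^n}$. *)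

theory Defs
  imports "HOL-Analysis.Analysis" "HOL-Number_Theory.Cong" "Graph_Theory.Graph_Theory"
begin

text \<open>Vertices are tuples indexed by \<open>{1..n}\<close>, encoded as functions that are \<open>undefined\<close> outside
  \<open>{1..n}\<close>, so that distinct functions are distinct tuples. Integer entries are used because the
  congruences involve subtraction.\<close>

definition torus_verts :: "nat \<Rightarrow> nat \<Rightarrow> (nat \<Rightarrow> int) set" where
  "torus_verts m n = {1..n} \<rightarrow>\<^sub>E {0..<int m}"

text \<open>As usual in this graph library, an undirected edge is a pair of opposite arcs.\<close>

definition torus :: "nat \<Rightarrow> nat \<Rightarrow> (nat \<Rightarrow> int) pair_pre_digraph" where
  "torus m n = \<lparr> pverts = torus_verts m n,
     parcs = {(u, v). u \<in> torus_verts m n \<and> v \<in> torus_verts m n \<and>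
       (\<exists>j\<in>{1..n}. ([u j = v j + 1] (mod int m) \<or> [u j = v j - 1] (mod int m)) \<and>
          (\<forall>i\<in>{1..n}. i \<noteq> j \<longrightarrow> u i = v i))} \<rparr>"

definition layer :: "nat \<Rightarrow> nat \<Rightarrow> int \<Rightarrow> (nat \<Rightarrow> int) set" where
  "layer m n p = {v \<in> pverts (torus m n). [(\<Sum>i=1..n. v i) = p] (mod int m)}"

definition nbrs :: "'a pair_pre_digraph \<Rightarrow> 'a \<Rightarrow> 'a set" where
  "nbrs G x = {y. (x, y) \<in> parcs G}"

definition nbr_set :: "'a pair_pre_digraph \<Rightarrow> 'a set \<Rightarrow> 'a set" where
  "nbr_set G X = (\<Union>x\<in>X. nbrs G x) - X"

definition nbr_set_in :: "'a pair_pre_digraph \<Rightarrow> 'a set \<Rightarrow> 'a set \<Rightarrow> 'a set" where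
  "nbr_set_in G X Y = nbr_set G X \<inter> Y"

lemma pair_graph_torus:
  assumes "m \<ge> 2"
  shows "pair_graph (torus m n)"
proof
  have fin: "finite (torus_verts m n)"
    unfolding torus_verts_def by (intro finite_PiE) auto
  show "finite (pverts (torus m n))"
    using fin by (simp add: torus_def)
  have "parcs (torus m n) \<subseteq> torus_verts m n \<times> torus_verts m n"
    by (auto simp: torus_def)
  then show "finite (parcs (torus m n))"
    using fin finite_subset by blast
  show "fst e \<in> pverts (torus m n)" "snd e \<in> pverts (torus m n)"
    if "e \<in> parcs (torus m n)" for e
    using that by (auto simp: torus_def)
  show "fst e \<noteq> snd e" if "e \<in> parcs (torus m n)" for e
  proof
    assume "fst e = snd e"
    with that obtain a where "[a = a + 1] (mod int m) \<or> [a = a - 1] (mod int m)"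
      by (fastforce simp: torus_def)
    then have "int m dvd 1"
      by (auto simp: cong_iff_dvd_diff)
    with assms show False by simp
  qed
  have flip: "[b = a + 1] (mod int m) \<or> [b = a - 1] (mod int m)"
    if "[a = b + 1] (mod int m) \<or> [a = b - 1] (mod int m)" for a b
    using that
  proof
    assume "[a = b + 1] (mod int m)"
    then have "int m dvd b - (a - 1)"
      using dvd_minus_iff[of "int m" "a - (b + 1)"]
      by (simp add: cong_iff_dvd_diff algebra_simps)
    then show ?thesis by (simp add: cong_iff_dvd_diff)
  next
    assume "[a = b - 1] (mod int m)"
    then have "int m dvd b - (a + 1)"
      using dvd_minus_iff[of "int m" "a - (b - 1)"]
      by (simp add: cong_iff_dvd_diff algebra_simps)
    then show ?thesis by (simp add: cong_iff_dvd_diff)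
  qed
  have "(v, u) \<in> parcs (torus m n)" if "(u, v) \<in> parcs (torus m n)" for u v
    using that flip by (fastforce simp: torus_def)
  then show "symmetric (with_proj (torus m n))"
    by (auto simp: symmetric_def intro: symI)
qed

end

theory Submission
  imports Defs
begin

text \<open>Dropping the last coordinate identifies every layer with the grid \<open>\<int>\<^sub>m\<^sup>n\<^sup>-\<^sup>1\<close> and turns the
  neighbourhood in the next layer into \<open>B + {0, \<plusminus>e\<^sub>1, \<dots>, \<plusminus>e\<^bsub>n-1\<^esub>}\<close>, with one fixed sign. The one-sided
  boundary of \<open>B\<close> is bounded below by a functional inequality in the style of Bobkov: with
  \<open>J t = t (1 - t)\<close> and the one-sided differences \<open>D\<^sub>j f\<close>,
  \<open>J (E f) \<le> E (sqrt ((J f)\<^sup>2 + m\<^sup>2/8 * \<Sum>\<^sub>j (D\<^sub>j f)\<^sup>2))\<close> for \<open>f\<close> with values in \<open>[0, 1]\<close>. In dimension one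
  this follows from Popoviciu's bound on the variance, since the descents of a function on a cycle
  sum to at least its oscillation; it tensorises by Minkowski's inequality. For an indicator
  function the right-hand side is supported on the boundary of \<open>B\<close> and is at most
  \<open>sqrt (m\<^sup>2 (n-1) / 8)\<close> there.\<close>

section \<open>Averages\<close>

definition avg :: "'a set \<Rightarrow> ('a \<Rightarrow> real) \<Rightarrow> real" where
  "avg S f = (\<Sum>x\<in>S. f x) / card S"

lemma avg_mono: "(\<And>x. x \<in> S \<Longrightarrow> f x \<le> g x) \<Longrightarrow> avg S f \<le> avg S g"
  unfolding avg_def by (intro divide_right_mono sum_mono) auto

lemma avg_cong: "(\<And>x. x \<in> S \<Longrightarrow> f x = g x) \<Longrightarrow> avg S f = avg S g"
  unfolding avg_def by simp

lemma avg_const: "finite S \<Longrightarrow> S \<noteq> {} \<Longrightarrow> avg S (\<lambda>_. c) = c"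
  unfolding avg_def by simp

lemma avg_diff: "avg S (\<lambda>x. f x - g x) = avg S f - avg S g"
  unfolding avg_def by (simp add: sum_subtractf diff_divide_distrib)

lemma avg_mult_left: "avg S (\<lambda>x. c * f x) = c * avg S f"
  unfolding avg_def by (simp add: sum_distrib_left)

lemma avg_nonneg: "(\<And>x. x \<in> S \<Longrightarrow> 0 \<le> f x) \<Longrightarrow> 0 \<le> avg S f"
  unfolding avg_def by (intro divide_nonneg_nonneg sum_nonneg) auto

lemma avg_bounds:
  assumes "finite S" "S \<noteq> {}" "\<And>x. x \<in> S \<Longrightarrow> lo \<le> f x \<and> f x \<le> hi"
  shows "lo \<le> avg S f" "avg S f \<le> hi"
  using avg_mono[of S "\<lambda>_. lo" f] avg_mono[of S f "\<lambda>_. hi"] assms by (auto simp: avg_const)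

text \<open>Fubini for the uniform measure: one coordinate splits off, which drives the induction on
  the dimension.\<close>

lemma avg_PiE_insert:
  assumes "k \<notin> I"
  shows "avg (PiE (insert k I) F) f = avg (F k) (\<lambda>i. avg (PiE I F) (\<lambda>x. f (x(k := i))))"
proof -
  have inj: "inj_on (\<lambda>(i, x). x(k := i)) (F k \<times> PiE I F)"
    by (rule inj_combinator[OF assms])
  have eq: "PiE (insert k I) F = (\<lambda>(i, x). x(k := i)) ` (F k \<times> PiE I F)"
    by (simp add: PiE_insert_eq)
  have "card (PiE (insert k I) F) = card (F k) * card (PiE I F)"
    by (simp add: eq card_image[OF inj] card_cartesian_product)
  moreover have "(\<Sum>x\<in>PiE (insert k I) F. f x) = (\<Sum>i\<in>F k. \<Sum>x\<in>PiE I F. f (x(k := i)))"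
    unfolding eq sum.reindex[OF inj] sum.cartesian_product by (simp add: case_prod_beta)
  ultimately show ?thesis
    by (simp add: avg_def sum_divide_distrib mult.commute)
qed

text \<open>The triangle inequality for the plane vectors with entries \<open>u x\<close> and
  \<open>v x\<close>. This form of Minkowski's inequality joins a bound along one direction with a
  bound along the others.\<close>

lemma sqrt_avg_le:
  "sqrt ((avg S u)\<^sup>2 + (avg S v)\<^sup>2) \<le> avg S (\<lambda>x. sqrt ((u x)\<^sup>2 + (v x)\<^sup>2))"
proof -
  have "cmod (\<Sum>x\<in>S. Complex (u x) (v x)) \<le> (\<Sum>x\<in>S. cmod (Complex (u x) (v x)))"
    by (rule norm_sum)
  then have *: "sqrt ((sum u S)\<^sup>2 + (sum v S)\<^sup>2) \<le> (\<Sum>x\<in>S. sqrt ((u x)\<^sup>2 + (v x)\<^sup>2))"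
    by (simp add: cmod_def)
  have "sqrt ((avg S u)\<^sup>2 + (avg S v)\<^sup>2) = sqrt ((sum u S)\<^sup>2 + (sum v S)\<^sup>2) / card S"
    by (simp add: avg_def power_divide real_sqrt_divide flip: add_divide_distrib)
  then show ?thesis
    using * by (simp add: avg_def divide_right_mono)
qed

text \<open>Averaging the nonnegative product \<open>(f x - lo) * (hi - f x)\<close> bounds the
  second moment; completing the square in \<open>avg S f\<close> then gives the constant.\<close>

lemma popoviciu_variance:
  assumes "finite S" "S \<noteq> {}" "\<And>x. x \<in> S \<Longrightarrow> lo \<le> f x \<and> f x \<le> hi"
  shows "avg S (\<lambda>x. (f x)\<^sup>2) - (avg S f)\<^sup>2 \<le> (hi - lo)\<^sup>2 / 4"
proof -
  have "0 \<le> avg S (\<lambda>x. (f x - lo) * (hi - f x))"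
    using assms(3) by (intro avg_nonneg mult_nonneg_nonneg) auto
  also have "\<dots> = avg S (\<lambda>x. ((lo + hi) * f x - (f x)\<^sup>2) - lo * hi)"
    by (intro avg_cong) (simp add: algebra_simps power2_eq_square)
  also have "\<dots> = (lo + hi) * avg S f - avg S (\<lambda>x. (f x)\<^sup>2) - lo * hi"
    using assms(1,2) by (simp add: avg_diff avg_mult_left avg_const)
  finally have "avg S (\<lambda>x. (f x)\<^sup>2) - (avg S f)\<^sup>2 \<le> (lo + hi) * avg S f - lo * hi - (avg S f)\<^sup>2"
    by simp
  also have "\<dots> \<le> (hi - lo)\<^sup>2 / 4"
    using zero_le_power2[of "2 * avg S f - lo - hi"]
    by (simp add: field_simps power2_eq_square)
  finally show ?thesis .
qed

section \<open>The functional inequality\<close>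

text \<open>As \<open>s\<close> generates the residues modulo \<open>m\<close>, steps of length
  \<open>s\<close> lead from \<open>a\<close> to \<open>b\<close> within one period. The drops along
  this walk telescope to \<open>g a - g b\<close>, and each is at most its positive part.\<close>

lemma oscillation_le_sum_descents:
  fixes g :: "int \<Rightarrow> real"
  assumes m: "m > 0" and s: "coprime s (int m)" and a: "a \<in> {0..<int m}" and b: "b \<in> {0..<int m}"
  shows "g a - g b \<le> (\<Sum>i\<in>{0..<int m}. max 0 (g ((i - s) mod int m) - g i))"
proof -
  \<comment> \<open>\<open>q\<close> is the walk from \<open>a\<close> in steps of \<open>s\<close>;
    its first \<open>m\<close> positions visit every residue exactly once.\<close>
  define q where "q t = (a + s * int t) mod int m" for t
  have inj: "inj_on q {..<m}"
  proof
    fix t t' assume t: "t \<in> {..<m}" "t' \<in> {..<m}" "q t = q t'"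
    then have "[s * int t = s * int t'] (mod int m)"
      by (simp add: q_def cong_add_lcancel flip: cong_def)
    then have "[int t = int t'] (mod int m)"
      using s by (simp add: cong_mult_lcancel)
    with t show "t = t'" by (simp add: cong_def)
  qed
  have sub: "q ` {..<m} \<subseteq> {0..<int m}"
    using m by (auto simp: q_def)
  have "q ` {..<m} = {0..<int m}"
    using sub by (rule card_subset_eq[rotated]) (simp_all add: card_image[OF inj])
  with b obtain k where k: "k < m" "q k = b"
    by (metis imageE lessThan_iff)
  have q0: "q 0 = a" using a by (simp add: q_def)
  have step: "(q (Suc t) - s) mod int m = q t" for t
    by (simp add: q_def mod_diff_left_eq algebra_simps)
  have "g a - g b = (\<Sum>t<k. g (q t) - g (q (Suc t)))"
    using sum_lessThan_telescope'[of "\<lambda>t. g (q t)" k] q0 k by simp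
  also have "\<dots> \<le> (\<Sum>t<k. max 0 (g ((q (Suc t) - s) mod int m) - g (q (Suc t))))"
    by (intro sum_mono) (simp add: step)
  also have "\<dots> = (\<Sum>t\<in>Suc ` {..<k}. max 0 (g ((q t - s) mod int m) - g (q t)))"
    by (simp add: sum.reindex)
  \<comment> \<open>The indices \<open>Suc t\<close> with \<open>t < k\<close> run from
    \<open>1\<close> to \<open>k\<close>, hence stay below \<open>m\<close>; the added terms are
    nonnegative.\<close>
  also have "\<dots> \<le> (\<Sum>t<m. max 0 (g ((q t - s) mod int m) - g (q t)))"
    using k by (intro sum_mono2) auto
  also have "\<dots> = (\<Sum>i\<in>q ` {..<m}. max 0 (g ((i - s) mod int m) - g i))"
    by (simp add: sum.reindex[OF inj])
  also have "\<dots> \<le> (\<Sum>i\<in>{0..<int m}. max 0 (g ((i - s) mod int m) - g i))"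
    using sub by (intro sum_mono2) auto
  finally show ?thesis .
qed

text \<open>Let \<open>J t = t * (1 - t)\<close> and let \<open>V\<close> be the variance of
  \<open>g\<close>. The average of \<open>J\<close> over the values of \<open>g\<close> falls short
  of \<open>J\<close> of the average by exactly \<open>V\<close>. Popoviciu bounds \<open>V\<close>
  by the squared oscillation, which the average descent controls, and Minkowski's inequality moves
  the average outside the root.\<close>

lemma bobkov_cycle:
  fixes g :: "int \<Rightarrow> real"
  assumes m: "m > 0" and s: "coprime s (int m)"
    and g: "\<And>i. i \<in> {0..<int m} \<Longrightarrow> 0 \<le> g i \<and> g i \<le> 1"
  defines "C \<equiv> {0..<int m}"
  shows "avg C g * (1 - avg C g) \<le>
    avg C (\<lambda>i. sqrt ((g i * (1 - g i))\<^sup>2 + (real m)\<^sup>2 / 8 * (max 0 (g ((i - s) mod int m) - g i))\<^sup>2))"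
    (is "?J \<le> avg C (\<lambda>i. sqrt ((?u i)\<^sup>2 + _ * (?d i)\<^sup>2))")
proof -
  have C: "finite C" "C \<noteq> {}" "card C = m"
    using m by (auto simp: C_def)
  define lo hi where "lo = Min (g ` C)" and "hi = Max (g ` C)"
  have rng: "lo \<le> g i \<and> g i \<le> hi" if "i \<in> C" for i
    using that C by (simp add: lo_def hi_def)
  have "hi \<in> g ` C" "lo \<in> g ` C"
    unfolding lo_def hi_def using C by (intro Max_in Min_in; simp)+
  then obtain a b where ab: "a \<in> C" "b \<in> C" "g a = hi" "g b = lo"
    by auto
  have lohi: "lo \<le> hi" using rng ab by force
  define V where "V = avg C (\<lambda>i. (g i)\<^sup>2) - (avg C g)\<^sup>2"
  have V: "V \<le> (hi - lo)\<^sup>2 / 4"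
    unfolding V_def using C rng by (intro popoviciu_variance) auto
  have "avg C ?u = avg C (\<lambda>i. g i - (g i)\<^sup>2)"
    by (intro avg_cong) (simp add: algebra_simps power2_eq_square)
  then have u: "avg C ?u = ?J - V"
    by (simp add: avg_diff V_def algebra_simps power2_eq_square)
  have "0 \<le> avg C (\<lambda>i. (g i - avg C g)\<^sup>2)"
    by (intro avg_nonneg) simp
  \<comment> \<open>Written as an iterated difference ending in a constant, so that linearity of
    \<open>avg\<close> splits it.\<close>
  also have "\<dots> = avg C (\<lambda>i. (g i)\<^sup>2 - 2 * avg C g * g i - - ((avg C g)\<^sup>2))"
    by (intro avg_cong) (simp add: power2_diff)
  also have "\<dots> = V"
    unfolding avg_diff avg_mult_left avg_const[OF C(1,2)]
    by (simp add: V_def power2_eq_square)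
  finally have V0: "0 \<le> V" .
  have "0 \<le> avg C g" "avg C g \<le> 1"
    using avg_bounds[of C 0 g 1] C g by (auto simp: C_def)
  then have J0: "0 \<le> ?J" by simp
  have J1: "?J \<le> 1 / 4"
    using zero_le_power2[of "2 * avg C g - 1"] by (simp add: field_simps power2_eq_square)
  have d: "(hi - lo) / m \<le> avg C ?d"
    using oscillation_le_sum_descents[OF m s, of a b g] ab C m
    by (simp add: avg_def divide_right_mono C_def)
  \<comment> \<open>The constant \<open>1/8\<close> is twice the product of the bound
    \<open>1/4\<close> on \<open>J\<close> and the factor \<open>1/4\<close> in Popoviciu's bound;
    the factor \<open>(real m)\<^sup>2\<close> pays for averaging the descents over \<open>m\<close>
    points.\<close>
  have "?J\<^sup>2 - (?J - V)\<^sup>2 = 2 * (V * ?J) - V\<^sup>2"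
    by (simp add: power2_eq_square algebra_simps)
  also have "\<dots> \<le> 2 * (V * ?J)" by simp
  also have "\<dots> \<le> 2 * (V * (1 / 4))"
    using V0 J1 by (intro mult_left_mono) auto
  also have "\<dots> \<le> (hi - lo)\<^sup>2 / 8" using V by simp
  also have "\<dots> = (real m)\<^sup>2 / 8 * ((hi - lo) / m)\<^sup>2"
    using m by (simp add: power_divide)
  also have "\<dots> \<le> (real m)\<^sup>2 / 8 * (avg C ?d)\<^sup>2"
    using d lohi by (intro mult_left_mono power_mono) auto
  finally have "?J\<^sup>2 \<le> (avg C ?u)\<^sup>2 + (real m)\<^sup>2 / 8 * (avg C ?d)\<^sup>2"
    using u by simp
  \<comment> \<open>The root of the constant moves into the average, giving the sum of two squared
    averages that \<open>sqrt_avg_le\<close> takes.\<close>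
  also have "\<dots> = (avg C ?u)\<^sup>2 + (avg C (\<lambda>i. real m / sqrt 8 * ?d i))\<^sup>2"
    unfolding avg_mult_left power_mult_distrib by (simp add: power_divide)
  finally have "?J \<le> sqrt ((avg C ?u)\<^sup>2 + (avg C (\<lambda>i. real m / sqrt 8 * ?d i))\<^sup>2)"
    by (rule real_le_rsqrt)
  also have "\<dots> \<le> avg C (\<lambda>i. sqrt ((?u i)\<^sup>2 + (real m / sqrt 8 * ?d i)\<^sup>2))"
    by (rule sqrt_avg_le)
  finally show ?thesis
    by (simp add: power_mult_distrib power_divide)
qed

text \<open>Tensorisation: for a new coordinate \<open>k\<close>, the cycle inequality is applied to
  the averages \<open>h i\<close> of \<open>f\<close> over the slices where coordinate
  \<open>k\<close> equals \<open>i\<close>. The induction hypothesis bounds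
  \<open>h i * (1 - h i)\<close> in each slice, and Minkowski's inequality combines this with the
  descents in direction \<open>k\<close>.\<close>

lemma bobkov_grid:
  fixes f :: "('a \<Rightarrow> int) \<Rightarrow> real"
  assumes "finite I" and m: "m > 0" and s: "coprime s (int m)"
    and "\<And>x. x \<in> PiE I (\<lambda>_. {0..<int m}) \<Longrightarrow> 0 \<le> f x \<and> f x \<le> 1"
  defines "G \<equiv> PiE I (\<lambda>_. {0..<int m})"
  shows "avg G f * (1 - avg G f) \<le>
    avg G (\<lambda>x. sqrt ((f x * (1 - f x))\<^sup>2 +
      (real m)\<^sup>2 / 8 * (\<Sum>j\<in>I. (max 0 (f (x(j := (x j - s) mod int m)) - f x))\<^sup>2)))"
  using assms(1,4) unfolding G_def
proof (induction I arbitrary: f rule: finite_induct)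
  case empty
  then show ?case by (simp add: avg_def)
next
  case (insert k I)
  define C where "C = {0..<int m}"
  define G where "G = PiE I (\<lambda>_. C)"
  define K where "K = (real m)\<^sup>2 / 8"
  have C: "finite C" "C \<noteq> {}" using m by (auto simp: C_def)
  have G: "finite G" "G \<noteq> {}"
    unfolding G_def using insert(1) C by (auto simp: PiE_eq_empty_iff intro!: finite_PiE)
  define h where "h i = avg G (\<lambda>x. f (x(k := i)))" for i
  \<comment> \<open>\<open>d i x\<close> is the descent in the new direction \<open>k\<close>;
    \<open>r i x\<close> below is the expression under the root for the slice
    \<open>i\<close>.\<close>
  define d where "d i x = max 0 (f (x(k := (i - s) mod int m)) - f (x(k := i)))" for i x
  define r where "r i x = (f (x(k := i)) * (1 - f (x(k := i))))\<^sup>2 +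
    K * (\<Sum>j\<in>I. (max 0 (f ((x(j := (x j - s) mod int m))(k := i)) - f (x(k := i))))\<^sup>2)" for i x
  have K0: "K \<ge> 0" by (simp add: K_def)
  have r0: "r i x \<ge> 0" for i x
    using K0 by (auto simp: r_def intro!: add_nonneg_nonneg mult_nonneg_nonneg sum_nonneg)
  have mem: "x(k := i) \<in> PiE (insert k I) (\<lambda>_. {0..<int m})" if "x \<in> G" "i \<in> C" for x i
    using that unfolding G_def C_def by (intro PiE_fun_upd)
  have f01: "0 \<le> f (x(k := i)) \<and> f (x(k := i)) \<le> 1" if "x \<in> G" "i \<in> C" for x i
    using insert.prems mem[OF that] by blast
  have h01: "0 \<le> h i \<and> h i \<le> 1" if "i \<in> C" for i
    unfolding h_def using avg_bounds[of G 0 "\<lambda>x. f (x(k := i))" 1] G f01 that by blast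
  have shift: "(i - s) mod int m \<in> C" for i
    using m by (simp add: C_def)
  have hr: "h i * (1 - h i) \<le> avg G (\<lambda>x. sqrt (r i x))" if "i \<in> C" for i
    unfolding h_def r_def K_def G_def C_def
    by (rule insert.IH[of "\<lambda>x. f (x(k := i))"]) (rule f01[OF _ that, unfolded G_def C_def])
  \<comment> \<open>Jensen's inequality for the convex function \<open>max 0\<close>: averaging over
    a slice cannot increase the descent.\<close>
  have hd: "max 0 (h ((i - s) mod int m) - h i) \<le> avg G (d i)" for i
  proof -
    have "h ((i - s) mod int m) - h i \<le> avg G (d i)"
      unfolding h_def avg_diff[symmetric] by (intro avg_mono) (simp add: d_def)
    moreover have "0 \<le> avg G (d i)" by (intro avg_nonneg) (simp add: d_def)
    ultimately show ?thesis by simp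
  qed
  have "avg (PiE (insert k I) (\<lambda>_. C)) f = avg C h"
    unfolding avg_PiE_insert[OF insert(2)] h_def G_def ..
  moreover have "avg C h * (1 - avg C h) \<le>
      avg C (\<lambda>i. sqrt ((h i * (1 - h i))\<^sup>2 + K * (max 0 (h ((i - s) mod int m) - h i))\<^sup>2))"
    unfolding K_def C_def by (intro bobkov_cycle m s) (use h01 in \<open>auto simp: C_def\<close>)
  moreover have "\<dots> \<le> avg C (\<lambda>i. avg G (\<lambda>x. sqrt (r i x + K * (d i x)\<^sup>2)))"
  proof (intro avg_mono)
    fix i assume i: "i \<in> C"
    have "sqrt ((h i * (1 - h i))\<^sup>2 + K * (max 0 (h ((i - s) mod int m) - h i))\<^sup>2)
        \<le> sqrt ((avg G (\<lambda>x. sqrt (r i x)))\<^sup>2 + K * (avg G (d i))\<^sup>2)"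
      using hr[OF i] hd[of i] h01[OF i] K0
      by (intro real_sqrt_le_mono add_mono mult_left_mono power_mono) auto
    also have "\<dots> = sqrt ((avg G (\<lambda>x. sqrt (r i x)))\<^sup>2 + (avg G (\<lambda>x. sqrt K * d i x))\<^sup>2)"
      using K0 by (simp add: avg_mult_left power_mult_distrib)
    also have "\<dots> \<le> avg G (\<lambda>x. sqrt ((sqrt (r i x))\<^sup>2 + (sqrt K * d i x)\<^sup>2))"
      by (rule sqrt_avg_le)
    finally show "sqrt ((h i * (1 - h i))\<^sup>2 + K * (max 0 (h ((i - s) mod int m) - h i))\<^sup>2)
        \<le> avg G (\<lambda>x. sqrt (r i x + K * (d i x)\<^sup>2))"
      using K0 r0 by (simp add: power_mult_distrib)
  qed
  moreover have "\<dots> = avg (PiE (insert k I) (\<lambda>_. C)) (\<lambda>x. sqrt ((f x * (1 - f x))\<^sup>2 +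
      K * (\<Sum>j\<in>insert k I. (max 0 (f (x(j := (x j - s) mod int m)) - f x))\<^sup>2)))"
  proof -
    have "r i x + K * (d i x)\<^sup>2 = (f (x(k := i)) * (1 - f (x(k := i))))\<^sup>2 +
      K * (\<Sum>j\<in>insert k I. (max 0 (f ((x(k := i))(j := ((x(k := i)) j - s) mod int m))
        - f (x(k := i))))\<^sup>2)" for i x
    proof -
      \<comment> \<open>Updates at \<open>j\<close> and \<open>k\<close> commute because
        \<open>k\<close> is not in \<open>I\<close>; the remaining summand \<open>j = k\<close> is
        the square of \<open>d i x\<close>.\<close>
      have "(\<Sum>j\<in>I. (max 0 (f ((x(k := i))(j := ((x(k := i)) j - s) mod int m)) - f (x(k := i))))\<^sup>2)
        = (\<Sum>j\<in>I. (max 0 (f ((x(j := (x j - s) mod int m))(k := i)) - f (x(k := i))))\<^sup>2)"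
        using insert(2) by (intro sum.cong refl) (metis fun_upd_other fun_upd_twist)
      then show ?thesis
        using insert(1,2) by (simp add: r_def d_def algebra_simps)
    qed
    then show ?thesis
      unfolding avg_PiE_insert[OF insert(2)] G_def by simp
  qed
  ultimately have "avg (PiE (insert k I) (\<lambda>_. C)) f * (1 - avg (PiE (insert k I) (\<lambda>_. C)) f) \<le>
    avg (PiE (insert k I) (\<lambda>_. C)) (\<lambda>x. sqrt ((f x * (1 - f x))\<^sup>2 +
      K * (\<Sum>j\<in>insert k I. (max 0 (f (x(j := (x j - s) mod int m)) - f x))\<^sup>2)))"
    by simp
  then show ?case
    unfolding C_def K_def by this
qed

section \<open>Vertex boundaries\<close>

text \<open>For the indicator \<open>f\<close> of \<open>B\<close>, the left side of the functional
  inequality is the density of \<open>B\<close> times that of its complement. As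
  \<open>f x * (1 - f x) = 0\<close>, only descents contribute on the right: at most
  \<open>card I\<close> of them, each of size at most one.\<close>

lemma grid_boundary:
  assumes I: "finite I" and m: "m > 0" and s: "coprime s (int m)"
  defines "G \<equiv> PiE I (\<lambda>_. {0..<int m})"
  assumes B: "B \<subseteq> G"
  shows "card B * (1 - card B / real m ^ card I) \<le>
    card {x \<in> G - B. \<exists>j\<in>I. x(j := (x j - s) mod int m) \<in> B} * sqrt ((real m)\<^sup>2 / 8 * card I)"
proof -
  define bd where "bd = {x \<in> G - B. \<exists>j\<in>I. x(j := (x j - s) mod int m) \<in> B}"
  define L where "L = (real m)\<^sup>2 / 8"
  have fG: "finite G" unfolding G_def using I by (intro finite_PiE) auto
  have cG: "card G = m ^ card I" unfolding G_def using I by (simp add: card_PiE)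
  define f :: "('a \<Rightarrow> int) \<Rightarrow> real" where "f x = of_bool (x \<in> B)" for x
  define w where "w x = sqrt ((f x * (1 - f x))\<^sup>2 +
      L * (\<Sum>j\<in>I. (max 0 (f (x(j := (x j - s) mod int m)) - f x))\<^sup>2))" for x
  have w: "w x \<le> of_bool (x \<in> bd) * sqrt (L * card I)" if "x \<in> G" for x
  proof (cases "x \<in> bd")
    case True
    have "(\<Sum>j\<in>I. (max 0 (f (x(j := (x j - s) mod int m)) - f x))\<^sup>2) \<le> (\<Sum>j\<in>I. 1)"
      by (intro sum_mono) (simp add: f_def)
    then have "L * (\<Sum>j\<in>I. (max 0 (f (x(j := (x j - s) mod int m)) - f x))\<^sup>2) \<le> L * card I"
      by (intro mult_left_mono) (auto simp: L_def)
    moreover have "(f x * (1 - f x))\<^sup>2 = 0" by (simp add: f_def)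
    ultimately show ?thesis using True by (simp only: w_def) simp
  next
    case False
    \<comment> \<open>Such a point lies in \<open>B\<close>, where \<open>f x = 1\<close> is already
      maximal, or none of its shifts lies in \<open>B\<close>.\<close>
    have "(\<Sum>j\<in>I. (max 0 (f (x(j := (x j - s) mod int m)) - f x))\<^sup>2) = 0"
      using False that by (intro sum.neutral) (auto simp: f_def bd_def)
    then show ?thesis using False by (simp add: w_def f_def)
  qed
  have "sum f G = card B"
    using B fG by (simp add: f_def Int_absorb1 flip: Int_def)
  then have af: "avg G f = card B / m ^ card I"
    by (simp add: avg_def cG)
  have "avg G f * (1 - avg G f) \<le> avg G w"
    unfolding w_def G_def L_def by (intro bobkov_grid I m s) (simp add: f_def)
  also have "\<dots> \<le> avg G (\<lambda>x. of_bool (x \<in> bd) * sqrt (L * card I))"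
    by (intro avg_mono w)
  also have "\<dots> = card bd * sqrt (L * card I) / m ^ card I"
  proof -
    have "G \<inter> {x. x \<in> bd} = bd" by (auto simp: bd_def)
    then show ?thesis using fG by (simp add: avg_def cG flip: sum_distrib_right)
  qed
  finally have "card B * (1 - card B / m ^ card I) / m ^ card I
      \<le> card bd * sqrt (L * card I) / m ^ card I"
    by (simp add: af)
  then show ?thesis
    using m by (simp add: divide_le_cancel bd_def L_def)
qed

section \<open>Layers as grids in one dimension fewer\<close>

lemma inj_on_restrict_layer:
  assumes "n \<ge> 1"
  shows "inj_on (\<lambda>v. restrict v {1..<n}) (layer m n p)"
proof
  fix u v assume u: "u \<in> layer m n p" and v: "v \<in> layer m n p"
    and eq: "restrict u {1..<n} = restrict v {1..<n}"
  have uv: "u \<in> torus_verts m n" "v \<in> torus_verts m n"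
    using u v by (auto simp: layer_def torus_def)
  have set_eq: "{1..n} = insert n {1..<n}" using assms by auto
  have lt: "u i = v i" if "i \<in> {1..<n}" for i
    using fun_cong[OF eq, of i] that by simp
  have "[(\<Sum>i=1..n. u i) = (\<Sum>i=1..n. v i)] (mod int m)"
    using u v by (auto simp: layer_def intro: cong_trans cong_sym)
  moreover have "(\<Sum>i\<in>{1..<n}. u i) = (\<Sum>i\<in>{1..<n}. v i)"
    using lt by simp
  \<comment> \<open>Both sums are congruent to \<open>p\<close> and the other entries agree, so the
    last entries are congruent.\<close>
  ultimately have "[u n = v n] (mod int m)"
    by (simp add: set_eq[unfolded One_nat_def] cong_add_rcancel)
  moreover have "u n \<in> {0..<int m}" "v n \<in> {0..<int m}"
    using uv assms by (auto simp: torus_verts_def)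
  ultimately have "u n = v n" by (simp add: cong_def)
  then show "u = v"
    using uv lt set_eq unfolding torus_verts_def by (metis PiE_ext insertE)
qed

text \<open>The last entry is the residue that completes the sum to \<open>p\<close>. Together with
  \<open>inj_on_restrict_layer\<close>, this makes dropping the last coordinate a bijection from
  each layer onto the grid.\<close>

lemma layer_extend:
  assumes "n \<ge> 1" "m > 0" "x \<in> PiE {1..<n} (\<lambda>_. {0..<int m})"
  obtains v where "v \<in> layer m n p" "restrict v {1..<n} = x"
proof
  define v where "v = x(n := (p - (\<Sum>i\<in>{1..<n}. x i)) mod int m)"
  have set_eq: "{1..n} = insert n {1..<n}" using assms by auto
  have "(\<Sum>i\<in>{1..<n}. v i) = (\<Sum>i\<in>{1..<n}. x i)"
    by (intro sum.cong) (auto simp: v_def)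
  moreover have "v n = (p - (\<Sum>i\<in>{1..<n}. x i)) mod int m"
    by (simp add: v_def)
  ultimately have "[(\<Sum>i=1..n. v i) = p] (mod int m)"
    by (simp add: set_eq[unfolded One_nat_def] cong_def mod_add_left_eq)
  moreover have "v \<in> torus_verts m n"
    unfolding torus_verts_def set_eq v_def using assms by (intro PiE_fun_upd) auto
  ultimately show "v \<in> layer m n p" by (simp add: layer_def torus_def)
  show "restrict v {1..<n} = x"
    using assms(3) by (auto simp: v_def restrict_def fun_eq_iff PiE_def extensional_def)
qed

text \<open>The coordinate sums of \<open>a\<close> and \<open>y\<close> differ by \<open>s\<close>
  modulo \<open>m\<close>. Agreement off \<open>j\<close> puts the whole difference at
  \<open>j\<close>, so the two vertices are adjacent.\<close>

lemma nbr_set_in_layerI: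
  assumes m: "m \<ge> 3" and s: "s \<in> {1, -1}"
    and A: "A \<subseteq> layer m n p" and a: "a \<in> A" and y: "y \<in> layer m n (p + s)"
    and j: "j \<in> {1..n}" and eq: "\<And>i. i \<in> {1..n} - {j} \<Longrightarrow> a i = y i"
  shows "y \<in> nbr_set_in (torus m n) A (layer m n (p + s))"
proof -
  \<comment> \<open>\<open>nbr_set\<close> discards \<open>A\<close> itself, but the layers of
    \<open>p\<close> and \<open>p + s\<close> are disjoint, since \<open>m\<close> does not divide
    \<open>s\<close>.\<close>
  have "y \<notin> A"
  proof
    assume "y \<in> A"
    then have "[(\<Sum>i=1..n. y i) = p] (mod int m)" "[(\<Sum>i=1..n. y i) = p + s] (mod int m)"
      using A y by (auto simp: layer_def)
    then have "[p + s = p] (mod int m)" by (meson cong_trans cong_sym)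
    then have "int m dvd s" by (simp add: cong_iff_dvd_diff)
    then have "int m dvd 1" using s by auto
    then show False using m by simp
  qed
  have "[(\<Sum>i=1..n. a i) = p] (mod int m)" "[(\<Sum>i=1..n. y i) = p + s] (mod int m)"
    using A a y by (auto simp: layer_def)
  then have "[(\<Sum>i=1..n. a i) - (\<Sum>i=1..n. y i) = p - (p + s)] (mod int m)"
    by (rule cong_diff)
  moreover have "(\<Sum>i=1..n. a i) - (\<Sum>i=1..n. y i) = a j - y j"
  proof -
    have "(\<Sum>i\<in>{1..n} - {j}. a i) = (\<Sum>i\<in>{1..n} - {j}. y i)" using eq by simp
    then show ?thesis
      unfolding sum.remove[OF finite_atLeastAtMost j] by simp
  qed
  ultimately have "[a j - y j = - s] (mod int m)" by simp
  then have "[a j = y j - s] (mod int m)"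
    by (simp add: cong_iff_dvd_diff algebra_simps)
  then have "[a j = y j + 1] (mod int m) \<or> [a j = y j - 1] (mod int m)"
    using s by auto
  moreover have "a \<in> torus_verts m n" "y \<in> torus_verts m n"
    using A a y by (auto simp: layer_def torus_def)
  ultimately have "(a, y) \<in> parcs (torus m n)"
    using j eq by (auto simp: torus_def)
  then show ?thesis
    using a y \<open>y \<notin> A\<close> by (auto simp: nbr_set_in_def nbr_set_def nbrs_def)
qed

text \<open>Adding \<open>s\<close> modulo \<open>m\<close> to the last entry of a point of
  \<open>A\<close> keeps its projection in \<open>B\<close>; adding \<open>s\<close> to an entry
  \<open>j < n\<close> moves the projection by \<open>s\<close> in direction \<open>j\<close>. Both
  give neighbours in the layer of \<open>p + s\<close>, and counting their projections suffices, as
  an image is never larger than its source.\<close>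

lemma card_nbr_set_in_layer_ge:
  assumes n: "n \<ge> 1" and m: "m \<ge> 3" and s: "s \<in> {1, -1}" and A: "A \<subseteq> layer m n p"
  defines "B \<equiv> (\<lambda>v. restrict v {1..<n}) ` A"
  shows "card B + card {x \<in> PiE {1..<n} (\<lambda>_. {0..<int m}) - B.
      \<exists>j\<in>{1..<n}. x(j := (x j - s) mod int m) \<in> B}
    \<le> card (nbr_set_in (torus m n) A (layer m n (p + s)))" (is "card B + card ?bd \<le> card ?N")
proof -
  have fl: "finite (layer m n q)" for q
    unfolding layer_def torus_def torus_verts_def by (auto intro!: finite_PiE)
  have fN: "finite ?N"
    by (rule finite_subset[OF _ fl[of "p + s"]]) (auto simp: nbr_set_in_def)
  have fB: "finite B"
    unfolding B_def using A fl finite_subset by blast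
  have fbd: "finite ?bd"
    by (rule finite_subset[of _ "PiE {1..<n} (\<lambda>_. {0..<int m})"]) (auto intro!: finite_PiE)
  have BG: "B \<subseteq> PiE {1..<n} (\<lambda>_. {0..<int m})"
    using A unfolding B_def by (fastforce simp: layer_def torus_def torus_verts_def PiE_def)
  have "B \<union> ?bd \<subseteq> (\<lambda>v. restrict v {1..<n}) ` ?N"
  proof
    fix x assume x: "x \<in> B \<union> ?bd"
    with BG have "x \<in> PiE {1..<n} (\<lambda>_. {0..<int m})" by auto
    then obtain y where y: "y \<in> layer m n (p + s)" "restrict y {1..<n} = x"
      using layer_extend n m by (metis less_le_trans zero_less_numeral)
    have xi: "x i = y i" if "i \<in> {1..<n}" for i
      using y(2) that by auto
    have "y \<in> ?N"
    proof (cases "x \<in> B")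
      case True
      then obtain a where a: "a \<in> A" "restrict a {1..<n} = x"
        by (auto simp: B_def)
      \<comment> \<open>\<open>a\<close> and \<open>y\<close> have the same projection
        \<open>x\<close>, so they can differ only in the last entry.\<close>
      have "a i = y i" if "i \<in> {1..n} - {n}" for i
        using fun_cong[OF a(2), of i] xi[of i] that by simp
      then show ?thesis
        using n by (intro nbr_set_in_layerI[OF m s A a(1) y(1), of n]) auto
    next
      case False
      with x obtain j where j: "j \<in> {1..<n}" "x(j := (x j - s) mod int m) \<in> B"
        by auto
      then obtain a where a: "a \<in> A" "restrict a {1..<n} = x(j := (x j - s) mod int m)"
        by (auto simp: B_def)
      have ai: "a i = y i" if "i \<in> {1..<n} - {j}" for i
        using fun_cong[OF a(2), of i] xi[of i] that by simp
      have "a j = (y j - s) mod int m"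
        using fun_cong[OF a(2), of j] xi[of j] j by simp
      then have aj: "[a j - y j = - s] (mod int m)"
        by (simp add: cong_def mod_diff_left_eq)
      \<comment> \<open>The sums of \<open>a\<close> and \<open>y\<close> differ by
        \<open>s\<close>, and entry \<open>j\<close> already accounts for this; the last entries are
        thus congruent, and equal because both lie below \<open>m\<close>.\<close>
      have "a n = y n"
      proof -
        have "[(\<Sum>i=1..n. a i) = p] (mod int m)" "[(\<Sum>i=1..n. y i) = p + s] (mod int m)"
          using A a y by (auto simp: layer_def)
        then have "[(\<Sum>i=1..n. a i) - (\<Sum>i=1..n. y i) = p - (p + s)] (mod int m)"
          by (rule cong_diff)
        then have "[(\<Sum>i=1..n. a i) - (\<Sum>i=1..n. y i) = - s] (mod int m)"
          by simp
        moreover have "(\<Sum>i=1..n. a i) - (\<Sum>i=1..n. y i) = a n - y n + (a j - y j)"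
        proof -
          have "{1..n} = insert n (insert j ({1..<n} - {j}))" using j by auto
          moreover have "(\<Sum>i\<in>{1..<n} - {j}. a i) = (\<Sum>i\<in>{1..<n} - {j}. y i)"
            using ai by simp
          moreover have "n \<notin> insert j ({1..<n} - {j})" "j \<notin> {1..<n} - {j}" using j by auto
          ultimately show ?thesis by (simp del: insert_Diff_single One_nat_def)
        qed
        ultimately have "[a n - y n + (a j - y j) - (a j - y j) = - s - - s] (mod int m)"
          using aj by (metis cong_diff)
        then have "[a n = y n] (mod int m)"
          by (simp add: cong_iff_dvd_diff)
        moreover have "a n \<in> {0..<int m}" "y n \<in> {0..<int m}"
          using subsetD[OF A a(1)] y(1) n
          by (auto simp: layer_def torus_def torus_verts_def dest!: PiE_mem[of _ _ _ n])
        ultimately show ?thesis by (simp add: cong_def)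
      qed
      then have "a i = y i" if "i \<in> {1..n} - {j}" for i
        using ai that by (cases "i = n") auto
      then show ?thesis
        using j by (intro nbr_set_in_layerI[OF m s A a(1) y(1), of j]) auto
    qed
    then show "x \<in> (\<lambda>v. restrict v {1..<n}) ` ?N"
      using y(2) by blast
  qed
  then have "card (B \<union> ?bd) \<le> card ?N"
    using fN by (meson card_image_le card_mono finite_imageI le_trans)
  moreover have "card (B \<union> ?bd) = card B + card ?bd"
    using fB fbd by (intro card_Un_disjoint) auto
  ultimately show ?thesis by simp
qed

section \<open>Transfer to the layers and comparison of constants\<close>

theorem theorem1p3:
  fixes m n l :: nat and p :: int and A :: "(nat \<Rightarrow> int) set" and \<alpha> :: real
  assumes "n \<ge> 1"
    and "m \<ge> 3"
    and "odd m"
    and "l = nat \<lfloor>real m / 2\<rfloor>"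
    and "p \<in> {0..<int m}"
    and "A \<subseteq> layer m n p"
    and "\<alpha> = real (card A) / real m ^ (n - 1)"
  shows "\<forall>s\<in>{1, -1}.
    real (card (nbr_set_in (torus m n) A (layer m n (p + s))))
      \<ge> real (card A) * (1 + (1 - \<alpha>) / sqrt (real l ^ 3 * real m * real n))"
proof
  fix s :: int assume s: "s \<in> {1, -1}"
  define B where "B = (\<lambda>v. restrict v {1..<n}) ` A"
  define bd where "bd = {x \<in> PiE {1..<n} (\<lambda>_. {0..<int m}) - B.
      \<exists>j\<in>{1..<n}. x(j := (x j - s) mod int m) \<in> B}"
  define R where "R = sqrt (real l ^ 3 * real m * real n)"
  have cB: "card B = card A"
    unfolding B_def using inj_on_subset[OF inj_on_restrict_layer[OF assms(1)] assms(6)]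
    by (rule card_image)
  have "B \<subseteq> PiE {1..<n} (\<lambda>_. {0..<int m})"
    using assms(6) unfolding B_def by (fastforce simp: layer_def torus_def torus_verts_def PiE_def)
  moreover have "coprime s (int m)" using s by auto
  \<comment> \<open>The grid has dimension \<open>n - 1\<close>, so its size is the denominator of
    \<alpha>, and \<open>B\<close> has the size of \<open>A\<close>.\<close>
  ultimately have "card A * (1 - \<alpha>) \<le> card bd * sqrt ((real m)\<^sup>2 / 8 * (n - 1))"
    using grid_boundary[of "{1..<n}" m s B] assms(1,2) by (simp add: bd_def cB assms(7))
  also have "\<dots> \<le> card bd * R"
  proof -
    have l: "m = 2 * l + 1"
      using assms(3,4) floor_divide_of_nat_eq[of m 2, where ?'a = real] by simp
    then have l1: "1 \<le> real l" using assms(2) by simp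
    then have "real l \<le> real l ^ 3" using self_le_power[of "real l" 3] by linarith
    then have "real m \<le> 8 * real l ^ 3" using l l1 by linarith
    \<comment> \<open>One factor \<open>m = 2 * l + 1\<close> is traded for
      \<open>8 * l ^ 3\<close>, whose \<open>8\<close> cancels the one in the functional inequality;
      \<open>n - 1\<close> is relaxed to \<open>n\<close>.\<close>
    then have "real m * (real m * real (n - 1)) \<le> 8 * real l ^ 3 * (real m * real n)"
      by (intro mult_mono) auto
    then show ?thesis
      unfolding R_def by (intro mult_left_mono real_sqrt_le_mono) (auto simp: power2_eq_square)
  qed
  finally have *: "card A * (1 - \<alpha>) \<le> card bd * R" .
  have "l > 0" using assms(2,4) by simp
  then have "R > 0" using assms(1,2) by (simp add: R_def)
  with * have "card A * (1 - \<alpha>) / R \<le> card bd"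
    by (simp add: pos_divide_le_eq)
  moreover have "card A + card bd \<le> card (nbr_set_in (torus m n) A (layer m n (p + s)))"
    using card_nbr_set_in_layer_ge[OF assms(1,2) s assms(6)] by (simp add: bd_def B_def flip: cB)
  ultimately show "card A * (1 + (1 - \<alpha>) / sqrt (real l ^ 3 * real m * real n))
      \<le> card (nbr_set_in (torus m n) A (layer m n (p + s)))"
    unfolding R_def by (simp add: algebra_simps)
qed

end
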